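(* For every integer $n\geq2$, \[ CP_{(2,2)}(n)=\frac{1+q^{2n-2}+q^{2n-1}}{(1-q^{2n-1})(1-q^{2n})}CP_{(2,2)}(n-1)+\frac{q^{2n-2}(1-q^{2n-3})}{(1-q^{2n-3})(1-q^{2n-2})(1-q^{2n-1})(1-q^{2n})}CP_{(2,2)}(n-2). \]
   Context: A cylindric partition with profile $(c_1,c_2)$ is a pair of partitions $(\lambda^{(1)},\lambda^{(2)})$ (parts weakly decreasing, $\lambda^{(i)}_j=0$ beyond the number of parts) with $\lambda^{(1)}_j\ge\lambda^{(2)}_{j+c_2}$ and $\lambda^{(2)}_j\ge\lambda^{(1)}_{j+c_1}$ for all $j\ge1$; its size is $|\lambda^{(1)}|+|\lambda^{(2)}|$. $CP_{(2,2)}(n)$ is the generating function $\sum q^{\text{size}}$ over cylindric partitions of profile $(2,2)$ in which each partition has at most $n$ parts, with $CP_{(2,2)}(0)=1$. *)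

theory Defs
  imports "HOL-Computational_Algebra.Formal_Power_Series"
begin

text \<open>A partition is the list of its positive parts, so \<open>length\<close> is the number of parts
  and \<open>sum_list\<close> is the size.\<close>

definition is_partition :: "nat list \<Rightarrow> bool" where
  "is_partition l \<longleftrightarrow> sorted_wrt (\<ge>) l \<and> 0 \<notin> set l"

text \<open>Parts are indexed from 1; \<open>part l j\<close> is only meaningful for \<open>j \<ge> 1\<close>.\<close>

definition part :: "nat list \<Rightarrow> nat \<Rightarrow> nat" where
  "part l j = (if j \<le> length l then l ! (j - 1) else 0)"

definition cylindric_partition :: "nat \<Rightarrow> nat \<Rightarrow> nat list \<times> nat list \<Rightarrow> bool" where
  "cylindric_partition c1 c2 = (\<lambda>(l1, l2).
     is_partition l1 \<and> is_partition l2 \<and>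
     (\<forall>j\<ge>1. part l1 j \<ge> part l2 (j + c2)) \<and>
     (\<forall>j\<ge>1. part l2 j \<ge> part l1 (j + c1)))"

definition cyl_size :: "nat list \<times> nat list \<Rightarrow> nat" where
  "cyl_size = (\<lambda>(l1, l2). sum_list l1 + sum_list l2)"

definition cyl_parts_le :: "nat \<Rightarrow> nat \<Rightarrow> nat \<Rightarrow> (nat list \<times> nat list) set" where
  "cyl_parts_le c1 c2 n =
     {p. cylindric_partition c1 c2 p \<and> length (fst p) \<le> n \<and> length (snd p) \<le> n}"

text \<open>The coefficients are non-negative integers; they are taken in the rationals so that division of
  power series by a series with non-zero constant term is available.\<close>

definition CP :: "nat \<Rightarrow> nat \<Rightarrow> nat \<Rightarrow> rat fps" where
  "CP c1 c2 n = Abs_fps (\<lambda>m. of_nat (card {p \<in> cyl_parts_le c1 c2 n. cyl_size p = m}))"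

text \<open>The counted sets are finite, so \<open>card\<close> is the true number of elements.\<close>

lemma finite_cyl_size: "finite {p \<in> cyl_parts_le c1 c2 n. cyl_size p = m}"
proof (rule finite_subset)
  let ?L = "{l. set l \<subseteq> {..m} \<and> length l \<le> n}"
  show "{p \<in> cyl_parts_le c1 c2 n. cyl_size p = m} \<subseteq> ?L \<times> ?L"
  proof
    fix p assume "p \<in> {p \<in> cyl_parts_le c1 c2 n. cyl_size p = m}"
    moreover obtain a b where p: "p = (a, b)" by (cases p)
    ultimately have *: "length a \<le> n" "length b \<le> n" "sum_list a + sum_list b = m"
      by (simp_all add: cyl_parts_le_def cyl_size_def)
    have "x \<le> m" if "x \<in> set a" for x
      using member_le_sum_list[OF that] *(3) by linarith
    moreover have "x \<le> m" if "x \<in> set b" for x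
      using member_le_sum_list[OF that] *(3) by linarith
    ultimately show "p \<in> ?L \<times> ?L" using * p by auto
  qed
  show "finite (?L \<times> ?L)"
    by (intro finite_cartesian_product finite_lists_length_le) auto
qed

lemma CP_0: "CP c1 c2 0 = 1"
proof (rule fps_ext)
  fix m
  have 1: "cyl_parts_le c1 c2 0 = {([], [])}"
  proof -
    have "cylindric_partition c1 c2 ([], [])"
      by (simp add: cylindric_partition_def is_partition_def part_def)
    then show ?thesis
      unfolding cyl_parts_le_def by auto
  qed
  have 2: "{p \<in> {([], [])}. cyl_size p = m} = (if m = 0 then {([], [])} else {})"
    by (auto simp add: cyl_size_def)
  show "fps_nth (CP c1 c2 0) m = fps_nth 1 m"
    unfolding CP_def 1 fps_nth_Abs_fps 2 by simp
qed

end

theory Submission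
  imports Defs
begin

text \<open>Let \<open>F a b\<close> count the cylindric partitions of profile \<open>(2,2)\<close> whose two partitions have at most
  \<open>a\<close> and \<open>b\<close> parts. If both numbers of parts are attained, 1 can be subtracted from all \<open>a + b\<close>
  entries, which preserves the inequalities when \<open>\<bar>a - b\<bar> \<le> 2\<close>; the remaining cylindric
  partitions are counted by inclusion-exclusion. With \<open>A n = F n n\<close>, \<open>B n = F n (n - 1)\<close> and
  \<open>C n = F n (n - 2)\<close> this gives
  \<open>(1 - q^(2n)) A n = 2 B n - A (n - 1)\<close>,
  \<open>(1 - q^(2n-1)) B n = A (n - 1) + C n - B (n - 1)\<close> and
  \<open>(1 - q^(2n-2)) C n = B (n - 1)\<close>, the last because
  \<open>n\<close> parts in the first partition force \<open>n - 2\<close> parts in the second. Eliminating \<open>B\<close> and \<open>C\<close>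
  yields the recurrence.\<close>

section \<open>Generating functions of boxes with separate length bounds\<close>

definition size_gf :: "(nat list \<times> nat list) set \<Rightarrow> rat fps" where
  "size_gf S = Abs_fps (\<lambda>m. of_nat (card {p \<in> S. cyl_size p = m}))"

text \<open>The two bounds are independent because lowering only one of them leaves the diagonal
  case counted by \<open>CP\<close>.\<close>

definition cyl_box :: "nat \<Rightarrow> nat \<Rightarrow> nat \<Rightarrow> nat \<Rightarrow> (nat list \<times> nat list) set" where
  "cyl_box c1 c2 a b =
     {p. cylindric_partition c1 c2 p \<and> length (fst p) \<le> a \<and> length (snd p) \<le> b}"

definition cyl_exact :: "nat \<Rightarrow> nat \<Rightarrow> nat \<Rightarrow> nat \<Rightarrow> (nat list \<times> nat list) set" where
  "cyl_exact c1 c2 a b =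
     {p. cylindric_partition c1 c2 p \<and> length (fst p) = a \<and> length (snd p) = b}"

text \<open>The padding makes the vanishing parts up to index \<open>a\<close> explicit, so they
  become ones.\<close>

definition raise_parts :: "nat \<Rightarrow> nat list \<Rightarrow> nat list" where
  "raise_parts a l = map Suc (l @ replicate (a - length l) 0)"

definition lower_parts :: "nat list \<Rightarrow> nat list" where
  "lower_parts l = filter (\<lambda>x. 0 < x) (map (\<lambda>x. x - 1) l)"

lemma CP_eq_size_gf: "CP c1 c2 n = size_gf (cyl_box c1 c2 n n)"
  by (simp add: CP_def size_gf_def cyl_parts_le_def cyl_box_def)

lemma finite_cyl_box_size: "finite {p \<in> cyl_box c1 c2 a b. cyl_size p = m}"
  by (rule finite_subset[OF _ finite_cyl_size[of c1 c2 "max a b" m]])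
     (auto simp: cyl_box_def cyl_parts_le_def)

section \<open>Raising and lowering all parts by one\<close>

lemma length_raise_parts: "length l \<le> a \<Longrightarrow> length (raise_parts a l) = a"
  by (simp add: raise_parts_def)

lemma sum_list_raise_parts: "length l \<le> a \<Longrightarrow> sum_list (raise_parts a l) = sum_list l + a"
proof -
  have "sum_list (map Suc xs) = sum_list xs + length xs" for xs
    by (induction xs) auto
  then show "length l \<le> a \<Longrightarrow> ?thesis"
    by (simp add: raise_parts_def sum_list_replicate)
qed

lemma part_raise_parts:
  assumes "length l \<le> a" "1 \<le> j"
  shows "part (raise_parts a l) j = (if j \<le> a then Suc (part l j) else 0)"
  using assms by (auto simp: part_def raise_parts_def nth_append)

lemma is_partition_raise_parts: "is_partition l \<Longrightarrow> is_partition (raise_parts a l)"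
proof -
  have "sorted_wrt (\<ge>) (replicate m (x :: nat))" for m x
    by (induction m) auto
  then show "is_partition l \<Longrightarrow> ?thesis"
    by (simp add: is_partition_def raise_parts_def sorted_wrt_append sorted_wrt_map)
qed

lemma is_partition_lower_parts: "is_partition l \<Longrightarrow> is_partition (lower_parts l)"
  by (auto simp: is_partition_def lower_parts_def sorted_wrt_map
      intro!: sorted_wrt_filter elim!: sorted_wrt_mono_rel[rotated])

lemma length_lower_parts: "length (lower_parts l) \<le> length l"
  unfolding lower_parts_def by (metis length_filter_le length_map)

text \<open>In a weakly decreasing list the ones form a tail, so the filter in
  \<open>lower_parts\<close> cuts off a tail, which the padding restores.\<close>

lemma raise_lower_parts: "is_partition l \<Longrightarrow> raise_parts (length l) (lower_parts l) = l"
proof (induction l)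
  case (Cons x xs)
  have IH: "raise_parts (length xs) (lower_parts xs) = xs"
    using Cons by (auto simp: is_partition_def)
  show ?case
  proof (cases "x = 1")
    case True
    have "y \<le> 1" if "y \<in> set xs" for y
      using Cons.prems that True by (simp add: is_partition_def)
    then have "lower_parts xs = []"
      by (simp add: lower_parts_def filter_empty_conv)
    moreover from True have "lower_parts (x # xs) = lower_parts xs"
      by (simp add: lower_parts_def)
    ultimately show ?thesis
      using IH True by (simp add: raise_parts_def)
  next
    case False
    then have "Suc (x - 1) = x" "lower_parts (x # xs) = (x - 1) # lower_parts xs"
      using Cons.prems by (auto simp: lower_parts_def is_partition_def)
    with IH show ?thesis
      by (simp add: raise_parts_def)
  qed
qed (simp add: raise_parts_def lower_parts_def)

lemma lower_raise_parts: "is_partition l \<Longrightarrow> lower_parts (raise_parts a l) = l"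
  by (auto simp: raise_parts_def lower_parts_def is_partition_def filter_id_conv o_def)
     (metis gr0I)

text \<open>Where the smaller side of an inequality is raised, the bounds on \<open>a\<close> and
  \<open>b\<close> ensure that the larger side is raised too. Where it is not raised, it is 0 before
  and after.\<close>

lemma cylindric_partition_raise_parts:
  assumes "is_partition l1" "is_partition l2" "length l1 \<le> a" "length l2 \<le> b"
    and "a \<le> b + c1" "b \<le> a + c2"
  shows "cylindric_partition c1 c2 (raise_parts a l1, raise_parts b l2) \<longleftrightarrow>
         cylindric_partition c1 c2 (l1, l2)"
proof -
  have *: "(\<forall>j\<ge>1. part (raise_parts a' l) j \<ge> part (raise_parts b' l') (j + c)) \<longleftrightarrow>
           (\<forall>j\<ge>1. part l j \<ge> part l' (j + c))"
    if "length l \<le> a'" "length l' \<le> b'" "b' \<le> a' + c" for a' b' c l l'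
  proof -
    have "part (raise_parts a' l) j \<ge> part (raise_parts b' l') (j + c) \<longleftrightarrow>
          part l j \<ge> part l' (j + c)" if "j \<ge> 1" for j
      using that \<open>length l \<le> a'\<close> \<open>length l' \<le> b'\<close> \<open>b' \<le> a' + c\<close>
      by (simp add: part_raise_parts) (simp add: part_def)
    then show ?thesis by blast
  qed
  show ?thesis
    using assms *[of l1 a l2 b c2] *[of l2 b l1 a c1]
    by (simp add: cylindric_partition_def is_partition_raise_parts)
qed

text \<open>Raising is a bijection from the box onto the pairs with exactly \<open>a\<close> and
  \<open>b\<close> parts, and it adds \<open>a + b\<close> to the size.\<close>

lemma size_gf_cyl_exact:
  assumes "a \<le> b + c1" "b \<le> a + c2"
  shows "size_gf (cyl_exact c1 c2 a b) = fps_X ^ (a + b) * size_gf (cyl_box c1 c2 a b)"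
proof (rule fps_ext)
  fix m
  let ?r = "\<lambda>(l1, l2). (raise_parts a l1, raise_parts b l2)"
  let ?s = "\<lambda>(l1, l2). (lower_parts l1, lower_parts l2)"
  have size_r: "cyl_size (?r p) = cyl_size p + (a + b)" if "p \<in> cyl_box c1 c2 a b" for p
    using that by (auto simp: cyl_box_def cyl_size_def sum_list_raise_parts split: prod.splits)
  have r: "?r p \<in> cyl_exact c1 c2 a b \<and> ?s (?r p) = p" if "p \<in> cyl_box c1 c2 a b" for p
  proof (cases p)
    case (Pair l1 l2)
    with that have l: "is_partition l1" "is_partition l2" "length l1 \<le> a" "length l2 \<le> b"
      "cylindric_partition c1 c2 (l1, l2)"
      by (auto simp: cyl_box_def cylindric_partition_def)
    with Pair assms show ?thesis
      by (simp add: cyl_exact_def cylindric_partition_raise_parts length_raise_parts lower_raise_parts)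
  qed
  have s: "?s p \<in> cyl_box c1 c2 a b \<and> ?r (?s p) = p" if "p \<in> cyl_exact c1 c2 a b" for p
  proof (cases p)
    case (Pair l1 l2)
    with that have l: "is_partition l1" "is_partition l2" "length l1 = a" "length l2 = b"
      "cylindric_partition c1 c2 (l1, l2)"
      by (auto simp: cyl_exact_def cylindric_partition_def)
    have rl: "raise_parts a (lower_parts l1) = l1" "raise_parts b (lower_parts l2) = l2"
      using l raise_lower_parts by auto
    have le: "length (lower_parts l1) \<le> a" "length (lower_parts l2) \<le> b"
      using l length_lower_parts by auto
    have "cylindric_partition c1 c2 (lower_parts l1, lower_parts l2)"
      using cylindric_partition_raise_parts[OF is_partition_lower_parts[OF l(1)]
          is_partition_lower_parts[OF l(2)] le assms] rl l(5) by simp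
    with Pair rl le show ?thesis by (simp add: cyl_box_def)
  qed
  have "card {p \<in> cyl_exact c1 c2 a b. cyl_size p = m} =
        (if m < a + b then 0 else card {p \<in> cyl_box c1 c2 a b. cyl_size p = m - (a + b)})"
  proof (cases "m < a + b")
    case True
    \<comment> \<open>Every pair in the exact class is a raised one, so its size is at least
      \<open>a + b\<close>.\<close>
    have "{p \<in> cyl_exact c1 c2 a b. cyl_size p = m} = {}"
      using True size_r s by fastforce
    with True show ?thesis by (simp only: card.empty if_True)
  next
    case False
    have "bij_betw ?r {p \<in> cyl_box c1 c2 a b. cyl_size p = m - (a + b)}
            {p \<in> cyl_exact c1 c2 a b. cyl_size p = m}"
    proof (rule bij_betw_byWitness[where f' = ?s])
      show "?r ` {p \<in> cyl_box c1 c2 a b. cyl_size p = m - (a + b)}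
              \<subseteq> {p \<in> cyl_exact c1 c2 a b. cyl_size p = m}"
        using r size_r False by force
      show "?s ` {p \<in> cyl_exact c1 c2 a b. cyl_size p = m}
              \<subseteq> {p \<in> cyl_box c1 c2 a b. cyl_size p = m - (a + b)}"
      proof (rule image_subsetI)
        fix p assume p: "p \<in> {p \<in> cyl_exact c1 c2 a b. cyl_size p = m}"
        then have "cyl_size (?r (?s p)) = cyl_size (?s p) + (a + b)"
          using s size_r by blast
        with p s[of p] show "?s p \<in> {p \<in> cyl_box c1 c2 a b. cyl_size p = m - (a + b)}"
          by simp
      qed
    qed (use r s in blast)+
    with False show ?thesis by (simp add: bij_betw_same_card)
  qed
  then show "fps_nth (size_gf (cyl_exact c1 c2 a b)) m =
             fps_nth (fps_X ^ (a + b) * size_gf (cyl_box c1 c2 a b)) m"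
    by (simp add: size_gf_def fps_X_power_mult_nth)
qed

section \<open>Inclusion-exclusion on boxes\<close>

lemma size_gf_Un_Int:
  assumes "S \<subseteq> cyl_box c1 c2 a b" "T \<subseteq> cyl_box c1 c2 a b"
  shows "size_gf (S \<union> T) + size_gf (S \<inter> T) = size_gf S + size_gf T"
proof (rule fps_ext)
  fix m
  let ?S = "{p \<in> S. cyl_size p = m}" and ?T = "{p \<in> T. cyl_size p = m}"
  \<comment> \<open>This is where containment in a box is used: \<open>card\<close> is additive only
    for finite sets.\<close>
  have "finite ?S" "finite ?T"
    using assms by (auto intro!: finite_subset[OF _ finite_cyl_box_size[of c1 c2 a b m]])
  then have "card ?S + card ?T = card (?S \<union> ?T) + card (?S \<inter> ?T)"
    by (rule card_Un_Int)
  moreover have "?S \<union> ?T = {p \<in> S \<union> T. cyl_size p = m}" "?S \<inter> ?T = {p \<in> S \<inter> T. cyl_size p = m}"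
    by auto
  ultimately show "fps_nth (size_gf (S \<union> T) + size_gf (S \<inter> T)) m =
      fps_nth (size_gf S + size_gf T) m"
    by (simp add: size_gf_def flip: of_nat_add)
qed

lemma one_minus_mult_eqI:
  fixes x :: "'a :: ring_1"
  assumes "g = e + u" "e = x * g"
  shows "(1 - x) * g = u"
proof -
  have "(1 - x) * g = g - e"
    using assms(2) by (simp add: left_diff_distrib)
  with assms(1) show ?thesis by simp
qed

lemma size_gf_empty [simp]: "size_gf {} = 0"
  by (rule fps_ext) (simp add: size_gf_def)

text \<open>Either both length bounds are attained, or the pair lies in one of two smaller boxes,
  whose intersection is again a box.\<close>

lemma size_gf_cyl_box_Suc_Suc:
  assumes "a \<le> b + c1" "b \<le> a + c2"
  shows "(1 - fps_X ^ (a + b + 2)) * size_gf (cyl_box c1 c2 (Suc a) (Suc b)) =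
         size_gf (cyl_box c1 c2 a (Suc b)) + size_gf (cyl_box c1 c2 (Suc a) b)
         - size_gf (cyl_box c1 c2 a b)"
proof -
  let ?G = "cyl_box c1 c2" and ?E = "cyl_exact c1 c2 (Suc a) (Suc b)"
  let ?U = "?G a (Suc b) \<union> ?G (Suc a) b"
  have sub: "?E \<subseteq> ?G (Suc a) (Suc b)" "?U \<subseteq> ?G (Suc a) (Suc b)"
    by (auto simp: cyl_box_def cyl_exact_def)
  have sets: "?E \<union> ?U = ?G (Suc a) (Suc b)" "?E \<inter> ?U = {}" "?G a (Suc b) \<inter> ?G (Suc a) b = ?G a b"
    by (auto simp: cyl_box_def cyl_exact_def)
  have "(1 - fps_X ^ (a + b + 2)) * size_gf (?G (Suc a) (Suc b)) = size_gf ?U"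
  proof (rule one_minus_mult_eqI)
    show "size_gf (?G (Suc a) (Suc b)) = size_gf ?E + size_gf ?U"
      using size_gf_Un_Int[OF sub] sets by simp
    show "size_gf ?E = fps_X ^ (a + b + 2) * size_gf (?G (Suc a) (Suc b))"
      using size_gf_cyl_exact[of "Suc a" "Suc b" c1 c2] assms by simp
  qed
  also have "size_gf ?U = size_gf (?G a (Suc b)) + size_gf (?G (Suc a) b) - size_gf (?G a b)"
    using size_gf_Un_Int[of "?G a (Suc b)" c1 c2 "Suc a" "Suc b" "?G (Suc a) b"] sub sets
    by (simp add: eq_diff_eq)
  finally show ?thesis .
qed

text \<open>At the extremal length difference, attaining the first bound forces the second to be
  attained, so a single smaller box remains.\<close>

lemma size_gf_cyl_box_extremal:
  assumes "Suc a = b + c1"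
  shows "(1 - fps_X ^ (Suc a + b)) * size_gf (cyl_box c1 c2 (Suc a) b) = size_gf (cyl_box c1 c2 a b)"
proof -
  let ?G = "cyl_box c1 c2" and ?E = "cyl_exact c1 c2 (Suc a) b"
  have full: "b \<le> length l2" if "cylindric_partition c1 c2 (l1, l2)" "length l1 = Suc a" for l1 l2
  proof (rule ccontr)
    assume "\<not> b \<le> length l2"
    \<comment> \<open>The inequality at \<open>j = b\<close> is violated: its right side is part
      \<open>b + c1 = Suc a\<close> of \<open>l1\<close>, the last and hence positive one.\<close>
    then have "b \<ge> 1" "part l2 b = 0" by (auto simp: part_def)
    moreover have "part l1 (b + c1) \<noteq> 0"
    proof -
      have "l1 ! a \<in> set l1" "0 \<notin> set l1"
        using that by (simp_all add: cylindric_partition_def is_partition_def)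
      then have "l1 ! a \<noteq> 0" by metis
      with that show ?thesis by (simp add: part_def flip: assms)
    qed
    ultimately show False
      using that(1) unfolding cylindric_partition_def by fastforce
  qed
  have sub: "?E \<subseteq> ?G (Suc a) b" "?G a b \<subseteq> ?G (Suc a) b"
    by (auto simp: cyl_box_def cyl_exact_def)
  have sets: "?E \<union> ?G a b = ?G (Suc a) b" "?E \<inter> ?G a b = {}"
    using full by (fastforce simp: cyl_box_def cyl_exact_def le_Suc_eq)+
  show ?thesis
  proof (rule one_minus_mult_eqI)
    show "size_gf (?G (Suc a) b) = size_gf ?E + size_gf (?G a b)"
      using size_gf_Un_Int[OF sub] sets by simp
    show "size_gf ?E = fps_X ^ (Suc a + b) * size_gf (?G (Suc a) b)"
      using size_gf_cyl_exact[of "Suc a" b c1 c2] assms by simp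
  qed
qed

lemma size_gf_cyl_box_swap: "size_gf (cyl_box c1 c2 a b) = size_gf (cyl_box c2 c1 b a)"
proof (rule fps_ext)
  fix m
  have "bij_betw prod.swap {p \<in> cyl_box c1 c2 a b. cyl_size p = m}
          {p \<in> cyl_box c2 c1 b a. cyl_size p = m}"
    by (rule bij_betw_byWitness[where f' = prod.swap])
       (auto simp: cyl_box_def cyl_size_def cylindric_partition_def)
  then show "fps_nth (size_gf (cyl_box c1 c2 a b)) m = fps_nth (size_gf (cyl_box c2 c1 b a)) m"
    by (simp add: size_gf_def bij_betw_same_card)
qed

section \<open>Profile (2,2): three recurrences and their elimination\<close>

lemma CP_2_2_Suc:
  "(1 - fps_X ^ (2 * n + 2)) * CP 2 2 (Suc n) = 2 * size_gf (cyl_box 2 2 (Suc n) n) - CP 2 2 n"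
proof -
  \<comment> \<open>The profile is symmetric, so the two off-diagonal boxes have equal series; hence
    the factor 2.\<close>
  have "2 * n + 2 = n + n + 2" by simp
  then show ?thesis
    using size_gf_cyl_box_Suc_Suc[of n n 2 2] size_gf_cyl_box_swap[of 2 2 n "Suc n"]
    by (simp only: CP_eq_size_gf mult_2 le_add1)
qed

text \<open>The same factor \<open>1 - x\<close> occurs with \<open>A1\<close> and with
  \<open>C\<close>, so multiplying by it removes both \<open>C\<close> and \<open>B0\<close> without
  any division.\<close>

lemma eliminate_auxiliary_series:
  fixes x y z :: "'a :: idom"
  assumes "(1 - z) * A2 = 2 * B1 - A1" "(1 - x) * A1 = 2 * B0 - A0"
    and "(1 - y) * B1 = A1 + C - B0" "(1 - x) * C = B0"
  shows "(1 - x) * (1 - y) * (1 - z) * A2 = (1 - x) * (1 + x + y) * A1 + x * A0"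
proof -
  have B0: "2 * B0 = (1 - x) * A1 + A0"
    using assms(2) by simp
  have "(1 - x) * (1 - y) * (1 - z) * A2 = (1 - x) * (1 - y) * ((1 - z) * A2)"
    by (simp only: mult.assoc)
  also have "\<dots> = (1 - x) * (2 * ((1 - y) * B1) - (1 - y) * A1)"
    unfolding assms(1) by (simp add: algebra_simps)
  also have "\<dots> = 2 * ((1 - x) * C) + (1 - x) * (2 * A1 - 2 * B0 - (1 - y) * A1)"
    unfolding assms(3) by (simp add: algebra_simps)
  \<comment> \<open>With \<open>(1 - x) * C = B0\<close>, the terms
    \<open>2 * B0 - 2 * (1 - x) * B0\<close> collapse to \<open>2 * x * B0\<close>.\<close>
  also have "\<dots> = x * (2 * B0) + (1 - x) * (1 + y) * A1"
    unfolding assms(4) by (simp add: algebra_simps)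
  also have "\<dots> = (1 - x) * (1 + x + y) * A1 + x * A0"
    unfolding B0 by (simp add: algebra_simps)
  finally show ?thesis .
qed

lemma CP_2_2_recurrence:
  fixes k :: nat
  defines "q \<equiv> \<lambda>i. fps_X ^ i :: rat fps"
  shows "(1 - q (2*k+2)) * (1 - q (2*k+3)) * (1 - q (2*k+4)) * CP 2 2 (k + 2) =
         (1 - q (2*k+2)) * (1 + q (2*k+2) + q (2*k+3)) * CP 2 2 (k + 1) + q (2*k+2) * CP 2 2 k"
proof -
  define A where "A = CP 2 2"
  define B where "B n = size_gf (cyl_box 2 2 (Suc n) n)" for n
  define C where "C = size_gf (cyl_box 2 2 (k + 2) k)"
  have A2: "(1 - q (2*k+4)) * A (k + 2) = 2 * B (k + 1) - A (k + 1)"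
  proof -
    have "2 * k + 4 = 2 * (k + 1) + 2" "k + 2 = Suc (k + 1)" by simp_all
    then show ?thesis
      using CP_2_2_Suc[of "k + 1"] by (simp only: A_def B_def q_def)
  qed
  have A1: "(1 - q (2*k+2)) * A (k + 1) = 2 * B k - A k"
    using CP_2_2_Suc[of k] by (simp add: A_def B_def q_def)
  have B1: "(1 - q (2*k+3)) * B (k + 1) = A (k + 1) + C - B k"
  proof -
    have le: "k + 1 \<le> k + 2" "k \<le> k + 1 + 2" by simp_all
    have "2 * k + 3 = k + 1 + k + 2" "k + 2 = k + 1 + 1" by simp_all
    then show ?thesis
      using size_gf_cyl_box_Suc_Suc[OF le]
      by (simp only: A_def B_def C_def q_def CP_eq_size_gf Suc_eq_plus1)
  qed
  have C1: "(1 - q (2*k+2)) * C = B k"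
  proof -
    \<comment> \<open>Lengths \<open>k + 2\<close> and \<open>k\<close> differ by
      \<open>c1 = 2\<close>, the extremal case.\<close>
    have Suc: "Suc (k + 1) = k + 2" by simp
    have "2 * k + 2 = k + 2 + k" "Suc k = k + 1" by simp_all
    then show ?thesis
      using size_gf_cyl_box_extremal[OF Suc, of 2] by (simp only: B_def C_def q_def Suc)
  qed
  have "(1 - q (2*k+2)) * (1 - q (2*k+3)) * (1 - q (2*k+4)) * A (k + 2) =
        (1 - q (2*k+2)) * (1 + q (2*k+2) + q (2*k+3)) * A (k + 1) + q (2*k+2) * A k"
    using A2 A1 B1 C1 by (rule eliminate_auxiliary_series)
  then show ?thesis by (simp add: A_def)
qed

section \<open>From the division-free recurrence to quotients\<close>

lemma fps_divide_eq_mult: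
  fixes f g h :: "'a :: field fps"
  assumes "g * h = 1"
  shows "f / g = f * h"
proof -
  have "fps_nth g 0 \<noteq> 0"
    using assms by (metis fps_mult_nth_0 fps_one_nth mult_zero_left zero_neq_one)
  then show ?thesis
    using assms by (metis fps_divide_unit fps_inverse_unique)
qed

text \<open>Here \<open>s\<close>, \<open>u\<close>, \<open>v\<close>, \<open>w\<close> are the
  inverses of \<open>d\<close>, \<open>x\<close>, \<open>y\<close>, \<open>z\<close>. The factor
  \<open>d\<close> stands for \<open>1 - q^(2n-3)\<close>, common to numerator and denominator in
  the target formula.\<close>

lemma solve_for_leading_term:
  fixes d :: "'a :: field fps"
  assumes inv: "d * s = 1" "x * u = 1" "y * v = 1" "z * w = 1"
    and rec: "x * y * z * A2 = x * P * A1 + Q * A0"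
  shows "A2 = P / (y * z) * A1 + (Q * d) / (d * x * y * z) * A0"
proof -
  have yz: "y * z * (v * w) = 1"
    by (metis inv(3,4) mult.assoc mult.left_commute mult_1_right)
  have "d * x * y * z * (s * u * v * w) = (d * s) * (x * u) * (y * z * (v * w))"
    by (simp only: mult_ac)
  with yz have "y * z * (v * w) = 1" "d * x * y * z * (s * u * v * w) = 1"
    by (simp_all add: inv)
  then have "P / (y * z) = P * (v * w)" "(Q * d) / (d * x * y * z) = Q * d * (s * u * v * w)"
    by (simp_all only: fps_divide_eq_mult)
  moreover have "A2 = P * (v * w) * A1 + Q * d * (s * u * v * w) * A0"
  proof -
    have "A2 = u * v * w * (x * y * z * A2)"
    proof -
      have "u * v * w * (x * y * z * A2) = (x * u) * (y * z * (v * w)) * A2"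
        by (simp only: mult_ac)
      then show ?thesis by (simp add: inv yz)
    qed
    \<comment> \<open>The factor \<open>1\<close> is a placeholder for \<open>d * s\<close>, which
      brings \<open>d\<close> into the second fraction.\<close>
    also have "\<dots> = (x * u) * (P * (v * w) * A1) + 1 * (u * v * w * Q * A0)"
      unfolding rec by (simp add: algebra_simps)
    also have "\<dots> = P * (v * w) * A1 + (d * s) * (u * v * w * Q * A0)"
      by (simp only: inv mult_1_left)
    also have "\<dots> = P * (v * w) * A1 + Q * d * (s * u * v * w) * A0"
      by (simp only: mult_ac)
    finally show ?thesis .
  qed
  ultimately show ?thesis by simp
qed

theorem theorem5p7:
  fixes n :: nat
  assumes "n \<ge> 2"
  shows "CP 2 2 n =
      (1 + fps_X ^ (2*n - 2) + fps_X ^ (2*n - 1))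
        / ((1 - fps_X ^ (2*n - 1)) * (1 - fps_X ^ (2*n)))
      * CP 2 2 (n - 1)
    + (fps_X ^ (2*n - 2) * (1 - fps_X ^ (2*n - 3)))
        / ((1 - fps_X ^ (2*n - 3)) * (1 - fps_X ^ (2*n - 2))
          * (1 - fps_X ^ (2*n - 1)) * (1 - fps_X ^ (2*n)))
      * CP 2 2 (n - 2)"
proof -
  \<comment> \<open>With this shift the truncated subtractions become exact, and the smallest
    exponent \<open>2*n - 3 = 2*k+1\<close> is positive, so all four factors are units.\<close>
  obtain k where k: "n = k + 2"
    using assms by (metis add.commute le_Suc_ex)
  define q :: "nat \<Rightarrow> rat fps" where "q i = fps_X ^ i" for i
  have unit: "(1 - q i) * inverse (1 - q i) = 1" if "i > 0" for i
    using that by (intro inverse_mult_eq_1') (simp add: q_def)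
  define u where "u i = inverse (1 - q i)" for i
  have u: "(1 - q (2*k+1)) * u (2*k+1) = 1" "(1 - q (2*k+2)) * u (2*k+2) = 1"
    "(1 - q (2*k+3)) * u (2*k+3) = 1" "(1 - q (2*k+4)) * u (2*k+4) = 1"
    unfolding u_def by (rule unit, simp)+
  have "(1 - q (2*k+2)) * (1 - q (2*k+3)) * (1 - q (2*k+4)) * CP 2 2 (k + 2) =
        (1 - q (2*k+2)) * (1 + q (2*k+2) + q (2*k+3)) * CP 2 2 (k + 1) + q (2*k+2) * CP 2 2 k"
    using CP_2_2_recurrence[of k] by (simp add: q_def)
  then have "CP 2 2 (k + 2) =
      (1 + q (2*k+2) + q (2*k+3)) / ((1 - q (2*k+3)) * (1 - q (2*k+4))) * CP 2 2 (k + 1)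
    + (q (2*k+2) * (1 - q (2*k+1)))
        / ((1 - q (2*k+1)) * (1 - q (2*k+2)) * (1 - q (2*k+3)) * (1 - q (2*k+4))) * CP 2 2 k"
    by (rule solve_for_leading_term[OF u])
  moreover have "2*n - 3 = 2*k+1" "2*n - 2 = 2*k+2" "2*n - 1 = 2*k+3" "2*n = 2*k+4"
    "n - 1 = k + 1" "n - 2 = k"
    using k by auto
  ultimately show ?thesis
    using k by (simp only: q_def)
qed

end
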